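(* Let $T>0$, $d\in\mathbb{N}$, $\alpha=(\alpha_1,\dots,\alpha_d)\in(0,1]^d$, and let $f=(f_1,\dots,f_d)^\top:[0,T]\times\mathbb{C}^d\to\mathbb{C}^d$ be continuous. Assume that there is a constant $L>0$ such that for every $i\in\{1,\dots,d\}$ $$|f_i(t,y)-f_i(t,z)|\le L\|y-z\|\qquad\text{for all } t\in[0,T],\ y,z\in\mathbb{C}^d,$$ where $\|y\|=\max\{|y_1|,\dots,|y_d|\}$. Then, for every $x_0=(x_1^0,\dots,x_d^0)^\top\in\mathbb{C}^d$, the multi-order fractional differential equation $$D_*^{\alpha}x(t)=f(t,x(t)),\quad t\in(0,T],$$ has a unique solution in $C([0,T];\mathbb{C}^d)$ that satisfies the initial condition $x(0)=x_0$.
   Context: $D_*^\alpha x=(D_*^{\alpha_1}x_1,\dots,D_*^{\alpha_d}x_d)^\top$ denotes the componentwise Caputo derivative. By definition, a solution of $D_*^\alpha x(t)=f(t,x(t))$ on $(0,T]$ with $x(0)=x_0$ is a continuous function $x:[0,T]\to\mathbb{C}^d$ satisfying the Volterra integral equation $$x_i(t)=x_i^0+\frac{1}{\Gamma(\alpha_i)}\int_0^t(t-s)^{\alpha_i-1}f_i(s,x(s))\,ds\qquad\text{for all } t\in[0,T],\ i=1,\dots,d.$$ *)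

theory Defs
  imports "HOL-Analysis.Analysis"
begin

definition max_norm :: "complex ^ 'n::finite \<Rightarrow> real" where
  "max_norm y = Max (range (\<lambda>i. cmod (y $ i)))"

text \<open>
  Riemann--Liouville fractional integral of order \<open>a\<close>. Where the kernel is evaluated at \<open>s = t\<close>
  Isabelle's \<open>0 powr (a - 1)\<close> is \<open>0\<close>, which affects the integrand on a null set only.
\<close>
definition RL_integral :: "real \<Rightarrow> (real \<Rightarrow> complex) \<Rightarrow> real \<Rightarrow> complex" where
  "RL_integral a g t =
     complex_of_real (1 / Gamma a) * (LBINT s:{0..t}. complex_of_real ((t - s) powr (a - 1)) * g s)"

text \<open>
  Solutions of the multi-order Caputo initial value problem \<open>D\<^sub>*\<^sup>\<alpha> x = f(t, x)\<close>, \<open>x(0) = x0\<close> are by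
  definition the continuous solutions of the associated Volterra equation. For \<open>f\<close> continuous on
  \<open>{0..T} \<times> UNIV\<close> and every \<open>\<alpha> $ i > 0\<close> the integrand is Lebesgue integrable for every continuous
  \<open>x\<close>, so the integrals are meaningful. Values of \<open>x\<close> outside \<open>{0..T}\<close> are irrelevant.
\<close>
definition caputo_solution ::
  "real \<Rightarrow> real ^ 'n \<Rightarrow> (real \<times> (complex ^ 'n) \<Rightarrow> complex ^ 'n) \<Rightarrow> complex ^ 'n \<Rightarrow>
    (real \<Rightarrow> complex ^ 'n::finite) \<Rightarrow> bool" where
  "caputo_solution T \<alpha> f x0 x \<longleftrightarrow>
     continuous_on {0..T} x \<and>
     (\<forall>t\<in>{0..T}. \<forall>i. x t $ i = x0 $ i + RL_integral (\<alpha> $ i) (\<lambda>s. f (s, x s) $ i) t)"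

end

theory Submission
  imports Defs
begin

text \<open>
  Scaling Euler's integral gives
  \<open>\<integral>\<^sub>0\<^sup>t u\<^bsup>a-1\<^esup> e\<^bsup>-l u\<^esup> du \<le> \<Gamma>(a) / l\<^bsup>a\<^esup>\<close>, so the fractional integral of order \<open>a\<close> maps
  functions bounded by \<open>K e\<^bsup>l s\<^esup>\<close> to functions bounded by \<open>K e\<^bsup>l t\<^esup> / l\<^bsup>a\<^esup>\<close>. Hence in the Bielecki norm
  \<open>sup e\<^bsup>-l t\<^esup> \<parallel>x(t)\<parallel>\<close> the Volterra operator has Lipschitz constant at most
  \<open>\<Sum>\<^sub>i L / l\<^bsup>\<alpha>\<^sub>i\<^esup>\<close>, which tends to \<open>0\<close> as \<open>l\<close> grows, whatever the orders are, and Banach's fixed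
  point theorem applies on all of \<open>[0, T]\<close> at once.
\<close>

section \<open>Euler's integral and integrability of the weakly singular kernel\<close>

lemma has_bochner_integral_Gamma_scaled:
  fixes a l :: real
  assumes "a > 0" "l > 0"
  shows "has_bochner_integral lborel
           (\<lambda>u. indicator {0..} u * (u powr (a - 1) * exp (- l * u))) (Gamma a / l powr a)"
proof -
  let ?G = "\<lambda>u::real. indicator {0..} u * u powr (a - 1) / exp u"
  have "has_bochner_integral lborel ?G (Gamma a)"
    using assms Gamma_real_pos[of a]
    by (intro has_bochner_integral_nn_integral) (auto simp: Gamma_conv_nn_integral_real)
  then have "has_bochner_integral lborel (\<lambda>u. ?G (0 + l * u)) (Gamma a /\<^sub>R \<bar>l\<bar>)"
    using assms by (subst lborel_has_bochner_integral_real_affine_iff [symmetric]) auto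
  \<comment> \<open>The substitution leaves a factor \<open>1 / l\<close>, and
    \<open>l powr (1 - a)\<close> turns \<open>(l * u) powr (a - 1)\<close> into
    \<open>u powr (a - 1)\<close>; together they give \<open>l powr (- a)\<close>.\<close>
  then have "has_bochner_integral lborel (\<lambda>u. ?G (l * u) * l powr (1 - a))
               (Gamma a / l * l powr (1 - a))"
    using assms by (intro has_bochner_integral_mult_left) (auto simp: field_simps)
  moreover have "?G (l * u) * l powr (1 - a) =
      indicator {0..} u * (u powr (a - 1) * exp (- l * u))" for u
    using assms by (auto simp: indicator_def powr_mult exp_minus field_simps zero_le_mult_iff
        simp flip: powr_add)
  moreover have "Gamma a / l * l powr (1 - a) = Gamma a / l powr a"
    using assms by (simp add: powr_diff)
  ultimately show ?thesis by simp
qed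

text \<open>The substitution \<open>u = t - s\<close> moves the singularity of the kernel to the
  fixed point \<open>0\<close>, so that \<open>t\<close> enters only through the domain and the
  argument of \<open>g\<close>.\<close>

lemma RL_integral_reflect:
  "RL_integral a g t =
     complex_of_real (1 / Gamma a) * (LBINT u:{0..t}. complex_of_real (u powr (a - 1)) * g (t - u))"
proof -
  have "(LBINT s:{0..t}. complex_of_real ((t - s) powr (a - 1)) * g s) =
        (LBINT u:{0..t}. complex_of_real (u powr (a - 1)) * g (t - u))"
    unfolding set_lebesgue_integral_def
    by (subst lborel_integral_real_affine[of "-1" _ t])
       (auto intro!: Bochner_Integration.integral_cong simp: indicator_def)
  then show ?thesis by (simp add: RL_integral_def)
qed

text \<open>Euler's integrand with \<open>l = 1\<close>, multiplied by \<open>exp t\<close>,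
  dominates: \<open>exp (t - u)\<close> is at least \<open>1\<close> for
  \<open>u \<le> t\<close>.\<close>

lemma set_integrable_powr_from_0:
  fixes a t :: real
  assumes "a > 0"
  shows "set_integrable lborel {0..t} (\<lambda>u. u powr (a - 1))"
proof -
  let ?G = "\<lambda>u::real. indicator {0..} u * (u powr (a - 1) * exp (- 1 * u))"
  have G: "integrable lborel (\<lambda>u. exp t * ?G u)"
    using has_bochner_integral_Gamma_scaled[OF assms zero_less_one]
    by (auto simp: has_bochner_integral_iff)
  show ?thesis
    unfolding set_integrable_def
  proof (rule Bochner_Integration.integrable_bound[OF G], goal_cases)
    case 2
    show ?case
    proof (rule AE_I2)
      fix u :: real
      have "u powr (a - 1) \<le> exp t * (u powr (a - 1) * exp (- u))" if "u \<le> t"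
        using mult_left_mono[of 1 "exp (t - u)" "u powr (a - 1)"] that
        by (simp add: exp_diff exp_minus field_simps)
      then show "norm (indicat_real {0..t} u *\<^sub>R u powr (a - 1)) \<le> norm (exp t * ?G u)"
        by (auto simp: indicator_def abs_mult)
    qed
  qed measurable
qed

text \<open>A continuous \<open>g\<close> is bounded on the compact interval, so a multiple of the
  integrable kernel dominates.\<close>

lemma set_integrable_RL_kernel:
  assumes "a > 0" "continuous_on {0..t} g"
  shows "set_integrable lborel {0..t} (\<lambda>u. complex_of_real (u powr (a - 1)) * g (t - u))"
proof -
  have g: "continuous_on {0..t} (\<lambda>u. g (t - u))"
    by (rule continuous_on_compose2[OF assms(2)]) (auto intro!: continuous_intros)
  obtain M where M: "\<And>u. u \<in> {0..t} \<Longrightarrow> norm (g (t - u)) \<le> M"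
    using compact_imp_bounded[OF compact_continuous_image[OF g compact_Icc]]
    unfolding bounded_iff by blast
  have meas: "set_borel_measurable lborel {0..t} (\<lambda>u. complex_of_real (u powr (a - 1)) * g (t - u))"
  proof -
    have "(\<lambda>u. indicator {0..t} u *\<^sub>R g (t - u)) \<in> borel_measurable borel"
      using g by (intro borel_measurable_continuous_on_indicator) auto
    then have "(\<lambda>u. complex_of_real (u powr (a - 1)) * (indicator {0..t} u *\<^sub>R g (t - u)))
                 \<in> borel_measurable borel"
      by measurable
    then show ?thesis by (simp add: set_borel_measurable_def)
  qed
  have int: "set_integrable lborel {0..t} (\<lambda>u. u powr (a - 1) * M)"
    using set_integrable_powr_from_0[OF assms(1)] by (rule set_integrable_mult_left)
  have "norm (complex_of_real (u powr (a - 1)) * g (t - u)) \<le> norm (u powr (a - 1) * M)"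
    if "u \<in> {0..t}" for u
    using order_trans[OF M[OF that] abs_ge_self]
    by (auto simp: norm_mult abs_mult intro!: mult_left_mono)
  then show ?thesis
    by (intro set_integrable_bound[OF int meas] AE_I2 impI)
qed

section \<open>Riemann-Liouville integral: linearity, growth bound, continuity in time\<close>

lemma RL_integral_diff:
  assumes "a > 0" "continuous_on {0..t} g" "continuous_on {0..t} h"
  shows "RL_integral a g t - RL_integral a h t = RL_integral a (\<lambda>s. g s - h s) t"
  unfolding RL_integral_reflect
  using set_integral_diff(2)[OF set_integrable_RL_kernel[OF assms(1,2)]
      set_integrable_RL_kernel[OF assms(1,3)]]
  by (simp add: right_diff_distrib)

lemma RL_integral_cong:
  assumes "\<And>s. s \<in> {0..t} \<Longrightarrow> g s = h s"
  shows "RL_integral a g t = RL_integral a h t"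
  unfolding RL_integral_def using assms
  by (intro arg_cong2[where f = "(*)"] refl set_lebesgue_integral_cong) auto

lemma RL_integral_0 [simp]: "RL_integral a g 0 = 0"
proof -
  \<comment> \<open>At \<open>u = 0\<close> the default value \<open>0 powr (a - 1) = 0\<close>
    makes the integrand vanish everywhere, not just almost everywhere.\<close>
  have *: "indicator {0..0} u *\<^sub>R (complex_of_real (u powr (a - 1)) * g (0 - u)) = 0" for u :: real
    by (simp add: indicator_def)
  show ?thesis
    unfolding RL_integral_reflect set_lebesgue_integral_def * by simp
qed

text \<open>Splitting \<open>exp (l * (t - u))\<close> as \<open>exp (l * t) * exp (- l * u)\<close>
  leaves the scaled Euler integral, whose \<open>Gamma a\<close> cancels the prefactor of the
  fractional integral.\<close>

lemma norm_RL_integral_le: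
  assumes "a > 0" "l > 0" "0 \<le> K"
    and g: "\<And>s. s \<in> {0..t} \<Longrightarrow> norm (g s) \<le> K * exp (l * s)"
  shows "norm (RL_integral a g t) \<le> K * exp (l * t) / l powr a"
proof -
  let ?G = "\<lambda>u::real. indicator {0..} u * (u powr (a - 1) * exp (- l * u))"
  let ?I = "LBINT u:{0..t}. complex_of_real (u powr (a - 1)) * g (t - u)"
  have G: "has_bochner_integral lborel (\<lambda>u. K * exp (l * t) * ?G u)
             (K * exp (l * t) * (Gamma a / l powr a))"
    by (intro has_bochner_integral_mult_right has_bochner_integral_Gamma_scaled assms)
  \<comment> \<open>Only the dominating function has to be integrable: a Bochner integral that does
    not exist is \<open>0\<close>, so both estimates hold for arbitrary \<open>g\<close>.\<close>
  have "norm ?I \<le> (LBINT u. norm (indicator {0..t} u *\<^sub>R (complex_of_real (u powr (a - 1)) * g (t - u))))"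
    unfolding set_lebesgue_integral_def by (rule integral_norm_bound)
  also have "\<dots> \<le> (LBINT u. K * exp (l * t) * ?G u)"
  proof (rule integral_mono_AE', goal_cases)
    case 2
    show ?case
    proof (rule AE_I2)
      fix u :: real
      show "norm (indicator {0..t} u *\<^sub>R (complex_of_real (u powr (a - 1)) * g (t - u)))
            \<le> K * exp (l * t) * ?G u"
      proof (cases "u \<in> {0..t}")
        case True
        then have "u powr (a - 1) * norm (g (t - u)) \<le> u powr (a - 1) * (K * exp (l * (t - u)))"
          by (intro mult_left_mono g) auto
        also have "\<dots> = K * exp (l * t) * (u powr (a - 1) * exp (- l * u))"
          by (simp add: right_diff_distrib exp_diff exp_minus field_simps)
        finally show ?thesis using True by (simp add: norm_mult)
      qed (use assms in \<open>auto simp: indicator_def\<close>)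
    qed
  qed (use G assms in \<open>auto simp: has_bochner_integral_iff\<close>)
  also have "\<dots> = K * exp (l * t) * (Gamma a / l powr a)"
    using G by (simp add: has_bochner_integral_iff)
  finally have "norm ?I \<le> K * exp (l * t) * (Gamma a / l powr a)" .
  then show ?thesis
    using Gamma_real_pos[OF assms(1)]
    by (simp add: RL_integral_reflect norm_divide norm_mult divide_le_eq mult_ac)
qed

text \<open>Dominated convergence along sequences: in the reflected form a single multiple of the
  kernel on \<open>{0..T}\<close> bounds the integrands for all times.\<close>

lemma continuous_on_RL_integral:
  assumes a: "a > 0" and g: "continuous_on {0..T} g"
  shows "continuous_on {0..T} (RL_integral a g)"
proof -
  obtain M where M: "\<And>s. s \<in> {0..T} \<Longrightarrow> norm (g s) \<le> M"
    using compact_imp_bounded[OF compact_continuous_image[OF g compact_Icc]]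
    unfolding bounded_iff by blast
  let ?h = "\<lambda>t u. indicator {0..t} u *\<^sub>R (complex_of_real (u powr (a - 1)) * g (t - u))"
  have h: "integrable lborel (?h t)" if "t \<in> {0..T}" for t
    using set_integrable_RL_kernel[OF a, of t g] continuous_on_subset[OF g, of "{0..t}"] that
    by (auto simp: set_integrable_def)
  have "(\<lambda>n. integral\<^sup>L lborel (?h (X n))) \<longlonglongrightarrow> integral\<^sup>L lborel (?h t)"
    if t: "t \<in> {0..T}" and X: "\<And>n. X n \<in> {0..T}" and lim: "X \<longlonglongrightarrow> t" for t X
  proof (rule integral_dominated_convergence)
    show "?h t \<in> borel_measurable lborel" "\<And>n. ?h (X n) \<in> borel_measurable lborel"
      using h[OF t] h[OF X] by auto
    show "integrable lborel (\<lambda>u. indicator {0..T} u *\<^sub>R (u powr (a - 1) * M))"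
      using set_integrable_mult_left[OF set_integrable_powr_from_0[OF a]]
      by (simp add: set_integrable_def)
    show "AE u in lborel. norm (?h (X n) u) \<le> indicator {0..T} u *\<^sub>R (u powr (a - 1) * M)" for n
    proof (rule AE_I2)
      fix u :: real
      \<comment> \<open>The sign of \<open>M\<close> settles those \<open>u\<close> in
        \<open>{0..T}\<close> beyond \<open>X n\<close>, where the left side is
        \<open>0\<close>.\<close>
      have "M \<ge> 0" using M[OF t] norm_ge_zero order_trans by blast
      then show "norm (?h (X n) u) \<le> indicator {0..T} u *\<^sub>R (u powr (a - 1) * M)"
        using M[of "X n - u"] X[of n] by (auto simp: indicator_def norm_mult intro!: mult_left_mono)
    qed
    \<comment> \<open>The null set \<open>{t}\<close> is removed because the indicator of
      \<open>{0..t}\<close> jumps there and \<open>X n\<close> may approach \<open>t\<close> from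
      either side.\<close>
    show "AE u in lborel. (\<lambda>n. ?h (X n) u) \<longlonglongrightarrow> ?h t u"
      using AE_lborel_singleton[of t]
    proof eventually_elim
      case (elim u)
      show ?case
      proof (cases "0 \<le> u \<and> u < t")
        case True
        have "\<forall>\<^sub>F n in sequentially. u < X n"
          using order_tendstoD(1)[OF lim] True by auto
        then have ev: "\<forall>\<^sub>F n in sequentially. ?h (X n) u = complex_of_real (u powr (a - 1)) * g (X n - u)"
          by eventually_elim (use True in auto)
        have "(\<lambda>n. g (X n - u)) \<longlonglongrightarrow> g (t - u)"
        proof (rule continuous_on_tendsto_compose[OF g])
          show "(\<lambda>n. X n - u) \<longlonglongrightarrow> t - u" by (intro tendsto_intros lim)
          show "\<forall>\<^sub>F n in sequentially. X n - u \<in> {0..T}"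
            using \<open>\<forall>\<^sub>F n in sequentially. u < X n\<close>
          proof eventually_elim
            case (elim n)
            then show ?case using True X[of n] by auto
          qed
        qed (use True t in auto)
        then show ?thesis
          using True by (subst tendsto_cong[OF ev]) (auto intro!: tendsto_intros)
      next
        case False
        then have "u < 0 \<or> t < u" using elim by auto
        then have ev: "\<forall>\<^sub>F n in sequentially. ?h (X n) u = 0"
        proof
          assume "t < u"
          with order_tendstoD(2)[OF lim] have "\<forall>\<^sub>F n in sequentially. X n < u" by auto
          then show ?thesis by eventually_elim auto
        qed auto
        have "?h t u = 0" using \<open>u < 0 \<or> t < u\<close> by auto
        with tendsto_eventually[OF ev] show ?thesis by (simp only:)
      qed
    qed
  qed
  then show ?thesis
    unfolding continuous_on_sequentially RL_integral_reflect set_lebesgue_integral_def comp_def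
    by (intro allI ballI impI tendsto_intros) auto
qed

section \<open>The Volterra operator and its Lipschitz estimate in the weighted norm\<close>

lemma max_norm_le_norm: "max_norm y \<le> norm y"
  by (auto simp: max_norm_def Finite_Cartesian_Product.norm_nth_le)

lemma tendsto_sum_divide_powr_at_top:
  fixes a :: "'a \<Rightarrow> real"
  assumes "\<And>i. i \<in> A \<Longrightarrow> a i > 0"
  shows "((\<lambda>l. \<Sum>i\<in>A. C / l powr a i) \<longlongrightarrow> 0) at_top"
proof -
  have "((\<lambda>l. C / l powr a i) \<longlongrightarrow> 0) at_top" if "i \<in> A" for i
    using tendsto_mult_right[OF tendsto_neg_powr[of "- a i" "\<lambda>l. l" at_top], of C] assms[OF that]
    by (simp add: powr_minus_divide filterlim_ident)
  then show ?thesis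
    using tendsto_sum[of A "\<lambda>i l. C / l powr a i" "\<lambda>_. 0" at_top] by simp
qed

definition volterra_op ::
  "real ^ 'n \<Rightarrow> (real \<times> (complex ^ 'n) \<Rightarrow> complex ^ 'n) \<Rightarrow> complex ^ 'n \<Rightarrow>
    (real \<Rightarrow> complex ^ 'n::finite) \<Rightarrow> real \<Rightarrow> complex ^ 'n" where
  "volterra_op \<alpha> f x0 x t = x0 + (\<chi> i. RL_integral (\<alpha> $ i) (\<lambda>s. f (s, x s) $ i) t)"

lemma caputo_solution_iff_volterra_op:
  "caputo_solution T \<alpha> f x0 x \<longleftrightarrow>
     continuous_on {0..T} x \<and> (\<forall>t\<in>{0..T}. x t = volterra_op \<alpha> f x0 x t)"
  by (simp add: caputo_solution_def volterra_op_def vec_eq_iff)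

lemma volterra_op_0 [simp]: "volterra_op \<alpha> f x0 x 0 = x0"
  by (simp add: volterra_op_def vec_eq_iff)

text \<open>Causality: functions that agree only on \<open>{0..T}\<close> can be exchanged under the
  operator at times in that interval.\<close>

lemma volterra_op_cong:
  assumes "\<And>s. s \<in> {0..t} \<Longrightarrow> x s = y s"
  shows "volterra_op \<alpha> f x0 x t = volterra_op \<alpha> f x0 y t"
  unfolding volterra_op_def vec_eq_iff
  using assms by (auto intro!: RL_integral_cong)

lemma continuous_on_superposition_nth:
  fixes f :: "real \<times> 'a::topological_space \<Rightarrow> 'b::topological_space ^ 'n"
  assumes "continuous_on ({0..T} \<times> UNIV) f" "continuous_on {0..T} x" "t \<le> T"
  shows "continuous_on {0..t} (\<lambda>s. f (s, x s) $ i)"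
proof -
  have "continuous_on {0..t} x"
    by (rule continuous_on_subset[OF assms(2)]) (use assms(3) in auto)
  then have "continuous_on {0..t} (\<lambda>s. f (s, x s))"
    using assms(3)
    by (intro continuous_on_compose2[OF assms(1), of "{0..t}" "\<lambda>s. (s, x s)"]
        continuous_on_Pair continuous_on_id) auto
  then show ?thesis by (rule continuous_on_component)
qed

lemma continuous_on_volterra_op:
  assumes "\<And>i. \<alpha> $ i > 0" "continuous_on ({0..T} \<times> UNIV) f" "continuous_on {0..T} x"
  shows "continuous_on {0..T} (volterra_op \<alpha> f x0 x)"
  unfolding volterra_op_def
  by (rule continuous_on_add[OF continuous_on_const], rule continuous_on_vec_lambda)
     (intro continuous_on_RL_integral continuous_on_superposition_nth[where T = T] assms order_refl)

text \<open>Each component obeys the growth bound with its own order. Estimating the Euclidean norm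
  by the sum of the components' moduli gives the sum over \<open>i\<close> in the constant.\<close>

lemma norm_volterra_op_diff_le:
  fixes \<alpha> :: "real ^ 'n::finite"
  assumes \<alpha>: "\<And>i. \<alpha> $ i > 0" and f: "continuous_on ({0..T} \<times> UNIV) f" and "L \<ge> 0"
    and lip: "\<And>i t y z. t \<in> {0..T} \<Longrightarrow> cmod (f (t, y) $ i - f (t, z) $ i) \<le> L * max_norm (y - z)"
    and x: "continuous_on {0..T} x" and y: "continuous_on {0..T} y"
    and "l > 0" "K \<ge> 0" and xy: "\<And>s. s \<in> {0..T} \<Longrightarrow> norm (x s - y s) \<le> K * exp (l * s)"
    and t: "t \<in> {0..T}"
  shows "norm (volterra_op \<alpha> f x0 x t - volterra_op \<alpha> f x0 y t)
           \<le> (\<Sum>i\<in>UNIV. L / l powr (\<alpha> $ i)) * K * exp (l * t)"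
proof -
  have "cmod ((volterra_op \<alpha> f x0 x t - volterra_op \<alpha> f x0 y t) $ i)
          \<le> L * K * exp (l * t) / l powr (\<alpha> $ i)" for i
  proof -
    have "(volterra_op \<alpha> f x0 x t - volterra_op \<alpha> f x0 y t) $ i =
        RL_integral (\<alpha> $ i) (\<lambda>s. f (s, x s) $ i - f (s, y s) $ i) t"
      using t by (subst RL_integral_diff [symmetric])
        (auto simp: volterra_op_def intro!: \<alpha> continuous_on_superposition_nth[OF f] x y)
    also have "cmod \<dots> \<le> L * K * exp (l * t) / l powr (\<alpha> $ i)"
    proof (rule norm_RL_integral_le)
      fix s assume "s \<in> {0..t}"
      then have s: "s \<in> {0..T}" using t by auto
      have "cmod (f (s, x s) $ i - f (s, y s) $ i) \<le> L * max_norm (x s - y s)"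
        by (rule lip[OF s])
      also have "\<dots> \<le> L * (K * exp (l * s))"
        using max_norm_le_norm xy[OF s] \<open>L \<ge> 0\<close> by (intro mult_left_mono) (auto intro: order_trans)
      finally show "cmod (f (s, x s) $ i - f (s, y s) $ i) \<le> L * K * exp (l * s)"
        by simp
    qed (use assms in auto)
    finally show ?thesis .
  qed
  then have "(\<Sum>i\<in>UNIV. cmod ((volterra_op \<alpha> f x0 x t - volterra_op \<alpha> f x0 y t) $ i))
      \<le> (\<Sum>i\<in>UNIV. L * K * exp (l * t) / l powr (\<alpha> $ i))"
    by (intro sum_mono)
  moreover have "norm (volterra_op \<alpha> f x0 x t - volterra_op \<alpha> f x0 y t)
      \<le> (\<Sum>i\<in>UNIV. cmod ((volterra_op \<alpha> f x0 x t - volterra_op \<alpha> f x0 y t) $ i))"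
    unfolding norm_vec_def by (rule L2_set_le_sum) auto
  moreover have "(\<Sum>i\<in>UNIV. L * K * exp (l * t) / l powr (\<alpha> $ i))
      = (\<Sum>i\<in>UNIV. L / l powr (\<alpha> $ i)) * K * exp (l * t)"
    by (simp add: sum_distrib_right)
  ultimately show ?thesis by linarith
qed

section \<open>Contraction argument and uniqueness\<close>

theorem theorem2p3:
  fixes T L :: real
    and \<alpha> :: "real ^ 'n::finite"
    and f :: "real \<times> (complex ^ 'n) \<Rightarrow> complex ^ 'n"
    and x0 :: "complex ^ 'n"
  assumes "T > 0"
    and "\<And>i. 0 < \<alpha> $ i \<and> \<alpha> $ i \<le> 1"
    and "continuous_on ({0..T} \<times> UNIV) f"
    and "L > 0"
    and "\<And>i t y z. t \<in> {0..T} \<Longrightarrow> cmod (f (t, y) $ i - f (t, z) $ i) \<le> L * max_norm (y - z)"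
  shows "\<exists>x. caputo_solution T \<alpha> f x0 x \<and> x 0 = x0 \<and>
           (\<forall>y. caputo_solution T \<alpha> f x0 y \<longrightarrow> (\<forall>t\<in>{0..T}. y t = x t))"
proof -
  \<comment> \<open>Any bound below \<open>1\<close> would yield a contraction; \<open>1 / 2\<close>
    is a convenient choice.\<close>
  have "\<forall>\<^sub>F l in at_top. (\<Sum>i\<in>UNIV. L / l powr (\<alpha> $ i)) < 1 / 2"
    using assms(2) by (intro order_tendstoD(2)[OF tendsto_sum_divide_powr_at_top]) auto
  then have "\<forall>\<^sub>F l in at_top. (\<Sum>i\<in>UNIV. L / l powr (\<alpha> $ i)) < 1 / 2 \<and> l > 0"
    using eventually_gt_at_top by (rule eventually_conj)
  then obtain l where l: "(\<Sum>i\<in>UNIV. L / l powr (\<alpha> $ i)) < 1 / 2" "l > 0"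
    using eventually_happens'[OF trivial_limit_at_top_linorder] by blast
  \<comment> \<open>Composing with \<open>c\<close> extends functions on \<open>{0..T}\<close>
    constantly to the real line, which places them in the complete type of bounded continuous
    functions.\<close>
  define c where "c = clamp 0 T"
  have c: "c t \<in> {0..T}" for t
    using clamp_in_interval[of 0 T t] \<open>T > 0\<close> by (simp add: c_def)
  have c_id: "c t = t" if "t \<in> {0..T}" for t
    using that by (simp add: c_def)
  define V where "V = volterra_op \<alpha> f x0"
  define W where "W u t = exp (l * t) *\<^sub>R u t" for u :: "real \<Rightarrow> complex ^ 'n" and t
    \<comment> \<open>the substitution \<open>x = W u\<close> turns the Bielecki norm of \<open>x\<close> into the supremum norm of \<open>u\<close>\<close>
  have "\<exists>v. \<forall>t. apply_bcontfun v t = exp (- l * c t) *\<^sub>R h (c t)"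
    if h: "continuous_on {0..T} h" for h :: "real \<Rightarrow> complex ^ 'n"
  proof -
    have "continuous_on (cbox 0 T) (\<lambda>t. exp (- l * t) *\<^sub>R h t)"
      using h by (auto intro!: continuous_intros)
    then show ?thesis unfolding c_def
      by (rule continuous_on_cbox_bcontfunE) (metis (no_types))
  qed
  then obtain E where E: "\<And>h t. continuous_on {0..T} h \<Longrightarrow>
      apply_bcontfun (E h) t = exp (- l * c t) *\<^sub>R (h (c t) :: complex ^ 'n)"
    by metis
  have W_cont: "continuous_on {0..T} (W (apply_bcontfun u))" for u :: "real \<Rightarrow>\<^sub>C (complex ^ 'n)"
    unfolding W_def by (intro continuous_intros) auto
  have V_cont: "continuous_on {0..T} (V x)" if "continuous_on {0..T} x" for x
    unfolding V_def using assms(2,3) that by (intro continuous_on_volterra_op) auto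
  define \<Phi> where "\<Phi> u = E (V (W (apply_bcontfun u)))"
    for u :: "real \<Rightarrow>\<^sub>C (complex ^ 'n)"
  have \<Phi>: "apply_bcontfun (\<Phi> u) t = exp (- l * c t) *\<^sub>R V (W (apply_bcontfun u)) (c t)" for u t
    unfolding \<Phi>_def by (rule E[OF V_cont[OF W_cont]])
  have "dist (\<Phi> u) (\<Phi> v) \<le> 1 / 2 * dist u v" for u v
  proof (rule dist_bound)
    fix t
    have "norm (W (apply_bcontfun u) s - W (apply_bcontfun v) s) \<le> dist u v * exp (l * s)" for s
    proof -
      have "norm (W (apply_bcontfun u) s - W (apply_bcontfun v) s) =
          exp (l * s) * dist (apply_bcontfun u s) (apply_bcontfun v s)"
        unfolding W_def scaleR_diff_right [symmetric] dist_norm by simp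
      also have "\<dots> \<le> exp (l * s) * dist u v"
        by (intro mult_left_mono dist_bounded) simp
      finally show ?thesis by (simp only: mult.commute)
    qed
    then have "norm (V (W (apply_bcontfun u)) (c t) - V (W (apply_bcontfun v)) (c t))
        \<le> (\<Sum>i\<in>UNIV. L / l powr (\<alpha> $ i)) * dist u v * exp (l * c t)"
      unfolding V_def using assms l c
      by (intro norm_volterra_op_diff_le[where T = T]) (auto intro: W_cont)
    also have "\<dots> \<le> 1 / 2 * dist u v * exp (l * c t)"
      using l by (intro mult_right_mono) auto
    \<comment> \<open>The weight \<open>exp (- l * c t)\<close> in \<open>\<Phi>\<close> cancels the
      growth factor \<open>exp (l * c t)\<close>.\<close>
    finally show "dist (apply_bcontfun (\<Phi> u) t) (apply_bcontfun (\<Phi> v) t) \<le> 1 / 2 * dist u v"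
      unfolding \<Phi> dist_norm [of "_ *\<^sub>R _"] scaleR_diff_right [symmetric] norm_scaleR
      by (simp add: exp_minus field_simps)
  qed
  then have "\<exists>!u. \<Phi> u = u"
    by (intro banach_fix_type[of "1 / 2"]) auto
  then obtain u where u: "\<Phi> u = u" and uniq: "\<And>v. \<Phi> v = v \<Longrightarrow> v = u"
    by blast
  let ?x = "W (apply_bcontfun u)"
  \<comment> \<open>Multiplying the fixed point equation by \<open>exp (l * t)\<close> removes the
    weight only where \<open>c t = t\<close>.\<close>
  have x: "?x t = V ?x t" if "t \<in> {0..T}" for t
    using \<Phi>[of u t] that by (simp add: u c_id W_def exp_minus)
  have "y t = ?x t" if y: "caputo_solution T \<alpha> f x0 y" and t: "t \<in> {0..T}" for y t
  proof -
    have y_cont: "continuous_on {0..T} y" and y_eq: "\<And>t. t \<in> {0..T} \<Longrightarrow> y t = V y t"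
      using y by (auto simp: caputo_solution_iff_volterra_op V_def)
    have Wy: "W (apply_bcontfun (E y)) s = y s" if "s \<in> {0..T}" for s
      using that by (simp add: W_def E[OF y_cont] c_id exp_minus)
    \<comment> \<open>Equality is required on the whole line, and holds there since both sides
      depend on \<open>s\<close> only through \<open>c s\<close>. Hence every solution is encoded by
      the one fixed point \<open>u\<close>.\<close>
    have "\<Phi> (E y) = E y"
    proof (rule bcontfun_eqI)
      fix s
      have "V (W (apply_bcontfun (E y))) (c s) = V y (c s)"
        unfolding V_def using c[of s] by (intro volterra_op_cong Wy) auto
      then show "apply_bcontfun (\<Phi> (E y)) s = apply_bcontfun (E y) s"
        using y_eq[OF c[of s]] by (simp add: \<Phi> E[OF y_cont])
    qed
    then show ?thesis using Wy[OF t] uniq by auto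
  qed
  moreover have "?x 0 = x0"
    using x[of 0] \<open>T > 0\<close> by (simp add: V_def)
  moreover have "caputo_solution T \<alpha> f x0 ?x"
    using W_cont x by (simp add: caputo_solution_iff_volterra_op V_def)
  ultimately show ?thesis by blast
qed

end
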